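(* For every graph $\Gamma$ there exists a graph $\Gamma'$ such that $\Gamma'$ admits a partial orientation as a quasi-transitive mixed graph and $\Gamma$ is an induced subgraph of $\Gamma'$.
   Context: A mixed graph has a vertex set, a set of (undirected) edges and a set of arcs, with at most one edge or arc between any pair of vertices. A partial orientation of a graph $\Gamma$ is a mixed graph obtained from $\Gamma$ by orienting some (possibly none or all) of its edges as arcs. A $2$-dipath is a directed path $uvw$ consisting of arcs $u\to v$ and $v\to w$; it is induced if $u$ and $w$ are not joined by an edge or arc. A mixed graph $H$ is quasi-transitive when (1) $H$ has no induced $2$-dipath, and (2) for every edge $uv$ of $H$ there is a vertex $w$ such that $uwv$ or $vwu$ is a $2$-dipath. *)

theory Defs
  imports Main
begin

record 'a ugraph =
  verts :: "'a set"
  edges :: "'a set set"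

definition simple_graph :: "('a, 'b) ugraph_scheme \<Rightarrow> bool" where
  "simple_graph G \<longleftrightarrow>
     (\<forall>e\<in>edges G. \<exists>u v. u \<in> verts G \<and> v \<in> verts G \<and> u \<noteq> v \<and> e = {u, v})"

definition induced_subgraph :: "'a ugraph \<Rightarrow> 'a ugraph \<Rightarrow> bool" where
  "induced_subgraph H G \<longleftrightarrow>
     verts H \<subseteq> verts G \<and> edges H = {e \<in> edges G. e \<subseteq> verts H}"

definition relabel :: "('a \<Rightarrow> 'b) \<Rightarrow> 'a ugraph \<Rightarrow> 'b ugraph" where
  "relabel f G = \<lparr>verts = f ` verts G, edges = (\<lambda>e. f ` e) ` edges G\<rparr>"

text \<open>In a mixed graph, \<open>edges\<close> holds only the undirected edges;
  \<open>(u, v) \<in> arcs M\<close> is the arc from \<open>u\<close> to \<open>v\<close>.\<close>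

record 'a mgraph = "'a ugraph" +
  arcs :: "('a \<times> 'a) set"

definition mixed_graph :: "'a mgraph \<Rightarrow> bool" where
  "mixed_graph M \<longleftrightarrow>
     simple_graph M \<and>
     (\<forall>u v. (u, v) \<in> arcs M \<longrightarrow>
        u \<in> verts M \<and> v \<in> verts M \<and> u \<noteq> v \<and>
        {u, v} \<notin> edges M \<and> (v, u) \<notin> arcs M)"

definition partial_orientation :: "'a mgraph \<Rightarrow> 'a ugraph \<Rightarrow> bool" where
  "partial_orientation M G \<longleftrightarrow>
     mixed_graph M \<and> verts M = verts G \<and>
     edges G = edges M \<union> {{u, v} | u v. (u, v) \<in> arcs M}"

definition joined :: "'a mgraph \<Rightarrow> 'a \<Rightarrow> 'a \<Rightarrow> bool" where
  "joined M u v \<longleftrightarrow> {u, v} \<in> edges M \<or> (u, v) \<in> arcs M \<or> (v, u) \<in> arcs M"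

definition two_dipath :: "'a mgraph \<Rightarrow> 'a \<Rightarrow> 'a \<Rightarrow> 'a \<Rightarrow> bool" where
  "two_dipath M u v w \<longleftrightarrow> (u, v) \<in> arcs M \<and> (v, w) \<in> arcs M \<and> u \<noteq> w"

definition induced_two_dipath :: "'a mgraph \<Rightarrow> 'a \<Rightarrow> 'a \<Rightarrow> 'a \<Rightarrow> bool" where
  "induced_two_dipath M u v w \<longleftrightarrow> two_dipath M u v w \<and> \<not> joined M u w"

definition quasi_transitive :: "'a mgraph \<Rightarrow> bool" where
  "quasi_transitive M \<longleftrightarrow>
     mixed_graph M \<and>
     (\<nexists>u v w. induced_two_dipath M u v w) \<and>
     (\<forall>u v. {u, v} \<in> edges M \<longrightarrow> (\<exists>w. two_dipath M u w v \<or> two_dipath M v w u))"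

end

theory Submission
  imports Defs
begin

text \<open>Keep every edge of \<open>\<Gamma>\<close> undirected. For each ordered pair \<open>(u, v)\<close> of adjacent vertices
  add a vertex \<open>w\<^bsub>uv\<^esub>\<close>, represented by \<open>Inr [u, v]\<close>, with arcs \<open>u \<rightarrow> w\<^bsub>uv\<^esub> \<rightarrow> v\<close>; the edge \<open>uv\<close> closes
  this 2-dipath and is witnessed by it. The only other 2-dipaths are \<open>w\<^bsub>uv\<^esub> \<rightarrow> v \<rightarrow> w\<^bsub>vx\<^esub>\<close>. Joining
  \<open>w\<^bsub>uv\<^esub>\<close> and \<open>w\<^bsub>vx\<^esub>\<close> by an undirected edge closes these, again with the dipath itself as witness,
  and creates no new arcs, so the construction stops here.\<close>

definition edge_gadget :: "'a ugraph \<Rightarrow> ('a + 'a list) mgraph" where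
  "edge_gadget G =
     \<lparr>verts = Inl ` verts G \<union> {Inr [u, v] | u v. {u, v} \<in> edges G},
      edges = {{Inl u, Inl v} | u v. {u, v} \<in> edges G} \<union>
              {{Inr [u, v], Inr [v, x]} | u v x. {u, v} \<in> edges G \<and> {v, x} \<in> edges G},
      arcs = {(Inl u, Inr [u, v]) | u v. {u, v} \<in> edges G} \<union>
             {(Inr [u, v], Inl v) | u v. {u, v} \<in> edges G}\<rparr>"

text \<open>The construction runs backwards: the mixed graph comes first, and the graph it partially
  orients is read off by forgetting directions.\<close>

definition underlying_graph :: "'a mgraph \<Rightarrow> 'a ugraph" where
  "underlying_graph M =
     \<lparr>verts = verts M, edges = edges M \<union> {{u, v} | u v. (u, v) \<in> arcs M}\<rparr>"

lemma partial_orientation_underlying_graph: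
  "mixed_graph M \<Longrightarrow> partial_orientation M (underlying_graph M)"
  by (simp add: partial_orientation_def underlying_graph_def)

lemma simple_graph_underlying_graph:
  "mixed_graph M \<Longrightarrow> simple_graph (underlying_graph M)"
  unfolding mixed_graph_def simple_graph_def underlying_graph_def ugraph.simps by blast

lemma simple_graph_edgeD:
  assumes "simple_graph G" "{u, v} \<in> edges G"
  shows "u \<in> verts G" "v \<in> verts G" "u \<noteq> v"
proof -
  obtain a b where "a \<in> verts G" "b \<in> verts G" "a \<noteq> b" "{u, v} = {a, b}"
    using assms unfolding simple_graph_def by blast
  then show "u \<in> verts G" "v \<in> verts G" "u \<noteq> v"
    by (auto simp: doubleton_eq_iff)
qed

lemma edge_gadget_arc_iff:
  "(a, b) \<in> arcs (edge_gadget G) \<longleftrightarrow>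
     (\<exists>u v. {u, v} \<in> edges G \<and>
       (a = Inl u \<and> b = Inr [u, v] \<or> a = Inr [u, v] \<and> b = Inl v))"
  by (auto simp: edge_gadget_def)

lemma edge_gadget_edge_iff:
  "e \<in> edges (edge_gadget G) \<longleftrightarrow>
     (\<exists>u v. {u, v} \<in> edges G \<and> e = {Inl u, Inl v}) \<or>
     (\<exists>u v x. {u, v} \<in> edges G \<and> {v, x} \<in> edges G \<and> e = {Inr [u, v], Inr [v, x]})"
  by (simp add: edge_gadget_def) blast

text \<open>Undirected edges stay inside one summand of the sum type and arcs cross between the two,
  so no pair carries both. Arcs in both directions between \<open>Inr [u, v]\<close> and an old
  vertex would force \<open>u = v\<close>.\<close>

lemma mixed_graph_edge_gadget:
  assumes "simple_graph G"
  shows "mixed_graph (edge_gadget G)"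
proof -
  note D = simple_graph_edgeD[OF assms]
  have "simple_graph (edge_gadget G)"
    unfolding simple_graph_def
  proof
    fix e
    assume "e \<in> edges (edge_gadget G)"
    then consider (orig) u v where "{u, v} \<in> edges G" "e = {Inl u, Inl v}"
      | (new) u v x where "{u, v} \<in> edges G" "{v, x} \<in> edges G" "e = {Inr [u, v], Inr [v, x]}"
      unfolding edge_gadget_edge_iff by blast
    then show "\<exists>a b. a \<in> verts (edge_gadget G) \<and> b \<in> verts (edge_gadget G) \<and> a \<noteq> b \<and> e = {a, b}"
    proof cases
      case orig
      then show ?thesis using D[OF orig(1)]
        by (intro exI[of _ "Inl u"] exI[of _ "Inl v"]) (auto simp: edge_gadget_def)
    next
      case new
      \<comment> \<open>The two labels differ already in their first entries, since
        \<open>u \<noteq> v\<close>; the case \<open>x = u\<close> is allowed.\<close>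
      then show ?thesis using D[OF new(1)]
        by (intro exI[of _ "Inr [u, v]"] exI[of _ "Inr [v, x]"]) (auto simp: edge_gadget_def)
    qed
  qed
  moreover have "a \<in> verts (edge_gadget G) \<and> b \<in> verts (edge_gadget G) \<and> a \<noteq> b \<and>
      {a, b} \<notin> edges (edge_gadget G) \<and> (b, a) \<notin> arcs (edge_gadget G)"
    if arc: "(a, b) \<in> arcs (edge_gadget G)" for a b
  proof -
    obtain u v where uv: "{u, v} \<in> edges G"
      and ab: "a = Inl u \<and> b = Inr [u, v] \<or> a = Inr [u, v] \<and> b = Inl v"
      using arc unfolding edge_gadget_arc_iff by blast
    have "{a, b} \<notin> edges (edge_gadget G)" "(b, a) \<notin> arcs (edge_gadget G)"
      using ab D(3)[OF uv]
      by (auto simp: edge_gadget_arc_iff edge_gadget_edge_iff doubleton_eq_iff)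
    moreover have "Inr [u, v] \<in> verts (edge_gadget G)" "Inl u \<in> verts (edge_gadget G)"
      "Inl v \<in> verts (edge_gadget G)"
      using uv D[OF uv] by (simp_all add: edge_gadget_def)
    ultimately show ?thesis
      using ab by auto
  qed
  ultimately show ?thesis
    unfolding mixed_graph_def by blast
qed

lemma quasi_transitive_edge_gadget:
  assumes "simple_graph G"
  shows "quasi_transitive (edge_gadget G)"
proof -
  note D = simple_graph_edgeD[OF assms]
  have "joined (edge_gadget G) a c" if "two_dipath (edge_gadget G) a b c" for a b c
  proof -
    \<comment> \<open>Arcs alternate between old and new vertices, so the middle vertex decides:
      \<open>Inr [u, v]\<close> has a single in-neighbour and a single out-neighbour, while at
      \<open>Inl v\<close> any label ending in \<open>v\<close> is followed by any label starting
      with \<open>v\<close>.\<close>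
    from that consider (orig) u v where "{u, v} \<in> edges G" "a = Inl u" "c = Inl v"
      | (new) u v x where "{u, v} \<in> edges G" "{v, x} \<in> edges G" "a = Inr [u, v]" "c = Inr [v, x]"
      unfolding two_dipath_def edge_gadget_arc_iff by (elim conjE exE disjE) auto
    then show ?thesis
      unfolding joined_def edge_gadget_edge_iff by cases blast+
  qed
  moreover have "\<exists>c. two_dipath (edge_gadget G) a c b \<or> two_dipath (edge_gadget G) b c a"
    if "{a, b} \<in> edges (edge_gadget G)" for a b
  proof -
    have orig: "two_dipath (edge_gadget G) (Inl u) (Inr [u, v]) (Inl v)"
      if "{u, v} \<in> edges G" for u v
      using that D[OF that] by (auto simp: two_dipath_def edge_gadget_arc_iff)
    have new: "two_dipath (edge_gadget G) (Inr [u, v]) (Inl v) (Inr [v, x])"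
      if "{u, v} \<in> edges G" "{v, x} \<in> edges G" for u v x
      using that D[OF that(1)] by (auto simp: two_dipath_def edge_gadget_arc_iff)
    \<comment> \<open>The set \<open>{a, b}\<close> fixes its ends only up to order; the disjunction
      over both directions absorbs the swap.\<close>
    show ?thesis
      using that orig new unfolding edge_gadget_edge_iff doubleton_eq_iff by blast
  qed
  ultimately show ?thesis
    using mixed_graph_edge_gadget[OF assms]
    unfolding quasi_transitive_def induced_two_dipath_def by blast
qed

text \<open>New vertices are labelled by ordered pairs of old ones, so the theorem also holds within
  finite graphs.\<close>

lemma finite_verts_edge_gadget:
  assumes "simple_graph G" "finite (verts G)"
  shows "finite (verts (edge_gadget G))"
proof (rule finite_subset)
  show "verts (edge_gadget G) \<subseteq>
      Inl ` verts G \<union> (\<lambda>(u, v). Inr [u, v]) ` (verts G \<times> verts G)"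
    using simple_graph_edgeD[OF assms(1)] by (auto simp: edge_gadget_def)
qed (use assms in simp)

lemma induced_subgraph_edge_gadget:
  fixes G :: "'a ugraph"
  assumes "simple_graph G"
  shows "induced_subgraph (relabel Inl G) (underlying_graph (edge_gadget G))"
proof -
  note D = simple_graph_edgeD[OF assms]
  \<comment> \<open>Simplicity turns the image of an edge under \<open>Inl\<close> into an explicit
    pair, the form used in \<open>edge_gadget\<close>.\<close>
  have edges: "edges (relabel Inl G :: ('a + 'a list) ugraph) =
      {{Inl u, Inl v} | u v. {u, v} \<in> edges G}"
  proof (intro equalityI subsetI)
    fix e :: "('a + 'a list) set"
    assume "e \<in> edges (relabel Inl G)"
    then obtain f where f: "f \<in> edges G" "e = Inl ` f"
      by (auto simp: relabel_def)
    then obtain u v where "f = {u, v}"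
      using assms by (auto simp: simple_graph_def)
    with f show "e \<in> {{Inl u, Inl v} | u v. {u, v} \<in> edges G}"
      by auto
  next
    fix e :: "('a + 'a list) set"
    assume "e \<in> {{Inl u, Inl v} | u v. {u, v} \<in> edges G}"
    then obtain u v where "{u, v} \<in> edges G" "e = Inl ` {u, v}"
      by auto
    then show "e \<in> edges (relabel Inl G)"
      by (simp only: relabel_def ugraph.simps imageI)
  qed
  have "edges (relabel Inl G) =
      {e \<in> edges (underlying_graph (edge_gadget G)). e \<subseteq> verts (relabel Inl G)}"
  proof (intro equalityI subsetI)
    fix e :: "('a + 'a list) set"
    assume "e \<in> edges (relabel Inl G)"
    then obtain u v where "{u, v} \<in> edges G" "e = {Inl u, Inl v}"
      unfolding edges by blast
    moreover from this have "e \<in> edges (edge_gadget G)"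
      unfolding edge_gadget_edge_iff by blast
    ultimately show "e \<in> {e \<in> edges (underlying_graph (edge_gadget G)). e \<subseteq> verts (relabel Inl G)}"
      using D by (simp add: underlying_graph_def relabel_def)
  next
    fix e
    assume "e \<in> {e \<in> edges (underlying_graph (edge_gadget G)). e \<subseteq> verts (relabel Inl G)}"
    then have e: "e \<in> edges (edge_gadget G) \<or> (\<exists>a b. (a, b) \<in> arcs (edge_gadget G) \<and> e = {a, b})"
      and "e \<subseteq> range Inl"
      by (auto simp: underlying_graph_def relabel_def)
    \<comment> \<open>Every arc and every added edge has an end in the right summand, so only copies
      of old edges survive.\<close>
    then have "Inr x \<notin> e" for x
      by blast
    with e show "e \<in> edges (relabel Inl G)"
      unfolding edges edge_gadget_arc_iff edge_gadget_edge_iff by blast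
  qed
  then show ?thesis
    by (auto simp: induced_subgraph_def underlying_graph_def edge_gadget_def relabel_def)
qed

theorem theorem2p1:
  fixes \<Gamma> :: "'a ugraph"
  assumes "simple_graph \<Gamma>"
  shows "\<exists>\<Gamma>' :: ('a + 'a list) ugraph.
           simple_graph \<Gamma>' \<and>
           (finite (verts \<Gamma>) \<longrightarrow> finite (verts \<Gamma>')) \<and>
           (\<exists>M. partial_orientation M \<Gamma>' \<and> quasi_transitive M) \<and>
           induced_subgraph (relabel Inl \<Gamma>) \<Gamma>'"
proof (intro exI conjI impI)
  let ?M = "edge_gadget \<Gamma>"
  \<comment> \<open>Unification with these two facts supplies the witnesses for
    \<open>\<Gamma>'\<close> and \<open>M\<close>.\<close>
  show "simple_graph (underlying_graph ?M)" "partial_orientation ?M (underlying_graph ?M)"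
    using mixed_graph_edge_gadget[OF assms]
    by (simp_all add: simple_graph_underlying_graph partial_orientation_underlying_graph)
  show "finite (verts (underlying_graph ?M))" if "finite (verts \<Gamma>)"
    using finite_verts_edge_gadget[OF assms that] by (simp add: underlying_graph_def)
qed (use assms in \<open>simp_all add: quasi_transitive_edge_gadget induced_subgraph_edge_gadget\<close>)

end
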